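(* Let $n\ge 3$ and $2\le k\le n-1$ be integers. Then the $k$-uniform hypercycle $C_n^{[k]}$ on $n$ vertices is integral if and only if $k=n-1$ or $(n,k)\in\{(4,2),(6,2),(6,3),(6,4)\}$.
   Context: A hypergraph $\mathcal H=(V,E)$ consists of a finite vertex set $V$ and a set $E$ of subsets of $V$, called edges. For a hypergraph on $n$ vertices $v_1,\dots,v_n$, its adjacency matrix $A(\mathcal H)=(a_{ij})$ is the $n\times n$ symmetric matrix with zero diagonal and, for $i\neq j$, $a_{ij}=|\{e\in E: v_i,v_j\in e\}|$. A hypergraph is integral if all eigenvalues of its adjacency matrix are integers. For integers $2\le k\le n-1$, the $k$-uniform hypercycle $C_n^{[k]}$ is the hypergraph with vertex set $V=\mathbb Z_n=\{0,1,\dots,n-1\}$ (integers modulo $n$) and edge set $E=\{e_j: j\in \mathbb Z_n\}$, where $e_j=\{j,j+1,\dots,j+k-1\}$ with all additions taken modulo $n$. *)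

theory Defs
  imports Complex_Main "Jordan_Normal_Form.Char_Poly"
begin

type_synonym 'a hypergraph = "'a set \<times> 'a set set"

definition is_hypergraph :: "'a hypergraph \<Rightarrow> bool" where
  "is_hypergraph H \<longleftrightarrow> finite (fst H) \<and> (\<forall>e \<in> snd H. e \<subseteq> fst H)"

definition codegree :: "'a hypergraph \<Rightarrow> 'a \<Rightarrow> 'a \<Rightarrow> nat" where
  "codegree H v w = card {e \<in> snd H. v \<in> e \<and> w \<in> e}"

text \<open>The list \<open>vs\<close> is an enumeration \<open>v\<^sub>1, \<dots>, v\<^sub>n\<close> of the vertices.
  The entries are complex so that \<open>eigenvalue\<close> ranges over all complex eigenvalues.\<close>

definition adjacency_matrix :: "'a hypergraph \<Rightarrow> 'a list \<Rightarrow> complex mat" where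
  "adjacency_matrix H vs = mat (length vs) (length vs)
     (\<lambda>(i, j). if i = j then 0 else of_nat (codegree H (vs ! i) (vs ! j)))"

definition integral_hypergraph :: "'a hypergraph \<Rightarrow> bool" where
  "integral_hypergraph H \<longleftrightarrow> is_hypergraph H \<and>
     (\<forall>vs. distinct vs \<and> set vs = fst H \<longrightarrow>
        (\<forall>x. eigenvalue (adjacency_matrix H vs) x \<longrightarrow> x \<in> \<int>))"

text \<open>Integers modulo \<open>n\<close> are represented by their residues \<open>0, \<dots>, n - 1\<close>.\<close>

definition hypercycle_edge :: "nat \<Rightarrow> nat \<Rightarrow> nat \<Rightarrow> nat set" where
  "hypercycle_edge n k j = {(j + i) mod n | i. i < k}"

definition hypercycle :: "nat \<Rightarrow> nat \<Rightarrow> nat hypergraph" where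
  "hypercycle n k = ({0..<n}, {hypercycle_edge n k j | j. j < n})"

lemma is_hypergraph_hypercycle: "is_hypergraph (hypercycle n k)"
  by (auto simp: is_hypergraph_def hypercycle_def hypercycle_edge_def)

text \<open>An enumeration-free description of the eigenvalues; in particular, they do not
  depend on the enumeration of the vertices.\<close>

lemma eigenvalue_adjacency_matrix_iff:
  assumes "distinct vs"
  shows "eigenvalue (adjacency_matrix H vs) x \<longleftrightarrow>
    (\<exists>f. (\<exists>v \<in> set vs. f v \<noteq> 0) \<and>
      (\<forall>v \<in> set vs. (\<Sum>w \<in> set vs - {v}. of_nat (codegree H v w) * f w) = x * f v))"
proof -
  let ?n = "length vs" and ?A = "adjacency_matrix H vs"
  have row: "(?A *\<^sub>v u) $ i =
      (\<Sum>w \<in> set vs - {vs ! i}. of_nat (codegree H (vs ! i) w) * f w)"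
    if u: "u \<in> carrier_vec ?n" "\<And>j. j < ?n \<Longrightarrow> u $ j = f (vs ! j)" and i: "i < ?n" for u f i
  proof -
    have bij: "bij_betw (\<lambda>j. vs ! j) {0..<?n} (set vs)"
      using assms by (simp add: bij_betw_nth lessThan_atLeast0)
    have "(?A *\<^sub>v u) $ i = (\<Sum>j \<in> {0..<?n}.
        (if vs ! j = vs ! i then 0 else of_nat (codegree H (vs ! i) (vs ! j))) * f (vs ! j))"
      using u i assms
      by (auto simp: adjacency_matrix_def scalar_prod_def nth_eq_iff_index_eq intro!: sum.cong)
    also have "\<dots> = (\<Sum>w \<in> set vs.
        (if w = vs ! i then 0 else of_nat (codegree H (vs ! i) w)) * f w)"
      by (rule sum.reindex_bij_betw[OF bij])
    also have "\<dots> = (\<Sum>w \<in> set vs - {vs ! i}. of_nat (codegree H (vs ! i) w) * f w)"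
      by (rule sum.mono_neutral_cong_right) auto
    finally show ?thesis .
  qed
  have dims: "dim_row ?A = ?n" by (simp add: adjacency_matrix_def)
  show ?thesis
  proof
    assume "eigenvalue ?A x"
    then obtain u where u: "u \<in> carrier_vec ?n" "u \<noteq> 0\<^sub>v ?n" "?A *\<^sub>v u = x \<cdot>\<^sub>v u"
      unfolding eigenvalue_def eigenvector_def dims by blast
    define f where "f v = u $ (THE j. j < ?n \<and> vs ! j = v)" for v
    have f: "u $ j = f (vs ! j)" if "j < ?n" for j
    proof -
      have "(THE i. i < ?n \<and> vs ! i = vs ! j) = j"
        using that assms by (auto simp: nth_eq_iff_index_eq)
      then show ?thesis by (simp add: f_def)
    qed
    obtain j where "j < ?n" "u $ j \<noteq> 0" using u(1,2) by (metis carrier_vecD eq_vecI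
      index_zero_vec(1,2))
    then have "\<exists>v \<in> set vs. f v \<noteq> 0" using f by auto
    moreover have "(\<Sum>w \<in> set vs - {v}. of_nat (codegree H v w) * f w) = x * f v"
      if v: "v \<in> set vs" for v
    proof -
      obtain i where i: "i < ?n" "v = vs ! i" using v by (metis in_set_conv_nth)
      show ?thesis using row[OF u(1) f i(1)] u(1,3) i f by simp
    qed
    ultimately show "\<exists>f. (\<exists>v \<in> set vs. f v \<noteq> 0) \<and>
      (\<forall>v \<in> set vs. (\<Sum>w \<in> set vs - {v}. of_nat (codegree H v w) * f w) = x * f v)" by blast
  next
    assume "\<exists>f. (\<exists>v \<in> set vs. f v \<noteq> 0) \<and>
      (\<forall>v \<in> set vs. (\<Sum>w \<in> set vs - {v}. of_nat (codegree H v w) * f w) = x * f v)"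
    then obtain f v where v: "v \<in> set vs" "f v \<noteq> 0"
      and f: "\<And>v. v \<in> set vs \<Longrightarrow>
        (\<Sum>w \<in> set vs - {v}. of_nat (codegree H v w) * f w) = x * f v" by blast
    define u where "u = vec ?n (\<lambda>j. f (vs ! j))"
    have u: "u \<in> carrier_vec ?n" "\<And>j. j < ?n \<Longrightarrow> u $ j = f (vs ! j)"
      by (simp_all add: u_def)
    obtain j where j: "j < ?n" "v = vs ! j" using v by (metis in_set_conv_nth)
    have "u \<noteq> 0\<^sub>v ?n" using u(2)[OF j(1)] v j by (metis index_zero_vec(1))
    moreover have "?A *\<^sub>v u = x \<cdot>\<^sub>v u"
    proof (rule eq_vecI)
      show "dim_vec (?A *\<^sub>v u) = dim_vec (x \<cdot>\<^sub>v u)" by (simp add: dims u_def)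
      fix i assume "i < dim_vec (x \<cdot>\<^sub>v u)"
      then have i: "i < ?n" by (simp add: u_def)
      show "(?A *\<^sub>v u) $ i = (x \<cdot>\<^sub>v u) $ i"
        using row[OF u i] f[of "vs ! i"] u i by simp
    qed
    ultimately show "eigenvalue ?A x"
      unfolding eigenvalue_def eigenvector_def dims using u(1) by blast
  qed
qed

end

(* The adjacency matrix is circulant, so its eigenvalues are the Fourier coefficients of the codegree
   c(d) of two vertices at distance d. If they are all integers, then c(M d) = c(d) for every M
   coprime to n. This is usually seen through the Galois group of the cyclotomic field; here it is
   shown by a congruence modulo each large prime p, which gives c(p d) = c(d), and M is replaced by a
   congruent number all of whose prime factors are large. But c(1) = k - 1 exceeds c(M) for
   2 <= M <= n - 2 when k <= n - 2, and a coprime M in this range exists unless n is 3, 4 or 6. *)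

theory Submission
  imports Defs "HOL-Number_Theory.Residues"
begin

section \<open>Roots of unity and their power sums\<close>

definition unity :: "nat \<Rightarrow> int \<Rightarrow> complex" where
  "unity n j = cis (2 * pi * of_int j / of_nat n)"

lemma unity_0 [simp]: "unity n 0 = 1"
  by (simp add: unity_def)

lemma unity_nonzero [simp]: "unity n j \<noteq> 0"
  by (simp add: unity_def)

lemma unity_add: "unity n (i + j) = unity n i * unity n j"
  by (simp add: unity_def cis_mult ring_distribs add_divide_distrib)

lemma unity_power: "unity n j ^ i = unity n (int i * j)"
  by (induction i) (simp_all add: unity_add ring_distribs)

lemma unity_eq_1_iff:
  assumes "n > 0"
  shows "unity n j = 1 \<longleftrightarrow> int n dvd j"
proof -
  let ?x = "2 * pi * of_int j / of_nat n"
  have "unity n j = 1 \<longleftrightarrow> cos ?x = 1"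
    using cos_one_sin_zero[of ?x] by (auto simp: unity_def complex_eq_iff)
  also have "\<dots> \<longleftrightarrow> (\<exists>m::int. ?x = 2 * pi * of_int m)"
    by (simp add: cos_one_2pi_int mult_ac)
  also have "\<dots> \<longleftrightarrow> (\<exists>m::int. j = int n * m)"
  proof -
    have "2 * pi * of_int j / of_nat n = 2 * pi * of_int m \<longleftrightarrow> j = int n * m" for m :: int
    proof -
      have "2 * pi * of_int j / of_nat n = 2 * pi * of_int m \<longleftrightarrow> real_of_int j = of_int (int n * m)"
        using assms by (auto simp: field_simps)
      then show ?thesis by (simp only: of_int_eq_iff)
    qed
    then show ?thesis by simp
  qed
  finally show ?thesis by (auto simp: dvd_def)
qed

lemma unity_cong:
  assumes "n > 0" "int n dvd i - j"
  shows "unity n i = unity n j"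
  using unity_add[of n "i - j" j] unity_eq_1_iff[of n "i - j"] assms by simp

lemma unity_mod_mult:
  assumes "n > 0"
  shows "unity n (i mod int n * m) = unity n (i * m)"
proof (rule unity_cong[OF assms])
  have "i mod int n * m - i * m = int n * (- (i div int n) * m)"
    by (simp add: minus_mult_div_eq_mod [symmetric] algebra_simps)
  then show "int n dvd i mod int n * m - i * m" by simp
qed

lemma sum_unity:
  assumes "n > 0"
  shows "(\<Sum>m<n. unity n (int m * j)) = (if int n dvd j then of_nat n else 0)"
proof (cases "int n dvd j")
  case True
  have "unity n (int m * j) = 1" for m
    using True assms by (simp add: unity_eq_1_iff)
  then show ?thesis using True by simp
next
  case False
  have "unity n j ^ n = 1"
    using assms by (simp add: unity_power unity_eq_1_iff)
  moreover have "unity n j \<noteq> 1" using False assms by (simp add: unity_eq_1_iff)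
  ultimately have "(\<Sum>m<n. unity n j ^ m) = 0" by (simp add: geometric_sum)
  then show ?thesis using False by (simp add: unity_power)
qed

section \<open>Fourier analysis on the integers modulo \<open>n\<close> and circulant
  matrices\<close>

lemma bij_betw_shift_mod:
  assumes "n > 0"
  shows "bij_betw (\<lambda>v. nat ((int v + s) mod int n)) {..<n} {..<n}"
  by (rule bij_betw_byWitness[where f' = "\<lambda>v. nat ((int v - s) mod int n)"])
    (use assms in \<open>auto simp: nat_less_iff mod_diff_left_eq mod_add_left_eq\<close>)

lemma bij_betw_reflect_mod:
  assumes "n > 0"
  shows "bij_betw (\<lambda>v. nat ((s - int v) mod int n)) {..<n} {..<n}"
  by (rule bij_betw_byWitness[where f' = "\<lambda>v. nat ((s - int v) mod int n)"])
    (use assms in \<open>auto simp: nat_less_iff mod_diff_right_eq\<close>)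

text \<open>Here and below, a function on the integers modulo \<open>n\<close> is encoded as a
  function on \<open>int\<close> that is invariant under reduction modulo \<open>n\<close>.
  Differences of vertices can then be inserted without reducing them.\<close>

lemma sum_shift_mod:
  fixes g :: "int \<Rightarrow> 'a :: comm_monoid_add"
  assumes "n > 0" "\<And>x. g (x mod int n) = g x"
  shows "(\<Sum>v<n. g (int v + s)) = (\<Sum>v<n. g (int v))"
  using sum.reindex_bij_betw[OF bij_betw_shift_mod[OF assms(1), of s], of "\<lambda>v. g (int v)"] assms
  by simp

lemma sum_reflect_mod:
  fixes g :: "int \<Rightarrow> 'a :: comm_monoid_add"
  assumes "n > 0" "\<And>x. g (x mod int n) = g x"
  shows "(\<Sum>v<n. g (s - int v)) = (\<Sum>v<n. g (int v))"
  using sum.reindex_bij_betw[OF bij_betw_reflect_mod[OF assms(1), of s], of "\<lambda>v. g (int v)"] assms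
  by simp

text \<open>Left unnormalised, so that its values are the eigenvalues themselves. It reads
  \<open>c\<close> only at the residues from 0 to \<open>n - 1\<close>, so that vectors such as
  \<open>\<lambda>d. f (nat d)\<close> can be transformed too.\<close>

definition fourier :: "nat \<Rightarrow> (int \<Rightarrow> complex) \<Rightarrow> int \<Rightarrow> complex" where
  "fourier n c m = (\<Sum>d<n. c (int d) * unity n (int d * m))"

lemma fourier_inversion:
  assumes "n > 0" "j < n"
  shows "(\<Sum>m<n. fourier n c (int m) * unity n (- (int m * int j))) = of_nat n * c (int j)"
proof -
  have "(\<Sum>m<n. fourier n c (int m) * unity n (- (int m * int j)))
     = (\<Sum>m<n. \<Sum>d<n. c (int d) * unity n (int m * (int d - int j)))"
    unfolding fourier_def sum_distrib_right
  proof (intro sum.cong refl)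
    fix m d
    have "unity n (int m * (int d - int j)) = unity n (int d * int m) * unity n (- (int m * int j))"
      by (simp add: algebra_simps flip: unity_add)
    then show "c (int d) * unity n (int d * int m) * unity n (- (int m * int j)) =
        c (int d) * unity n (int m * (int d - int j))" by simp
  qed
  also have "\<dots> = (\<Sum>d<n. c (int d) * (\<Sum>m<n. unity n (int m * (int d - int j))))"
    by (subst sum.swap) (simp add: sum_distrib_left)
  also have "\<dots> = (\<Sum>d<n. if d = j then of_nat n * c (int d) else 0)"
  proof (intro sum.cong refl)
    fix d assume "d \<in> {..<n}"
    then have "int n dvd int d - int j \<longleftrightarrow> d = j"
      using assms by (auto simp: mod_eq_dvd_iff[symmetric])
    then show "c (int d) * (\<Sum>m<n. unity n (int m * (int d - int j))) =
        (if d = j then of_nat n * c (int d) else 0)"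
      using assms by (simp add: sum_unity)
  qed
  finally show ?thesis using assms by simp
qed

text \<open>Substituting \<open>d = w - v\<close> splits off the factor at \<open>v\<close>.
  Characters never vanish, so every Fourier coefficient is an eigenvalue.\<close>

lemma fourier_eigenvector:
  assumes "n > 0" "\<And>x. c (x mod int n) = c x"
  shows "(\<Sum>w<n. c (int w - int v) * unity n (int w * m)) = fourier n c m * unity n (int v * m)"
proof -
  have "(\<Sum>w<n. c (int w - int v) * unity n (int w * m))
      = (\<Sum>w<n. (\<lambda>d. c d * unity n (d * m)) (int w + (- int v))) * unity n (int v * m)"
    unfolding sum_distrib_right
  proof (intro sum.cong refl)
    fix w
    have "unity n (int w * m) = unity n ((int w + - int v) * m) * unity n (int v * m)"
      by (simp add: algebra_simps flip: unity_add)
    then show "c (int w - int v) * unity n (int w * m) =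
        (\<lambda>d. c d * unity n (d * m)) (int w + (- int v)) * unity n (int v * m)" by simp
  qed
  also have "(\<Sum>w<n. (\<lambda>d. c d * unity n (d * m)) (int w + (- int v))) = fourier n c m"
    unfolding fourier_def
  proof (rule sum_shift_mod[OF assms(1)])
    fix x
    show "c (x mod int n) * unity n (x mod int n * m) = c x * unity n (x * m)"
      using assms unity_mod_mult by simp
  qed
  finally show ?thesis .
qed

text \<open>The converse: there are no other eigenvalues. By Fourier inversion the eigenvector
  \<open>f\<close> has a nonzero coefficient at some \<open>m\<close>. Pairing the eigenvalue
  equation with that character and swapping the sums gives \<open>x\<close> times this coefficient
  on one side and \<open>fourier n c (- m)\<close> times it on the other. The sign comes from
  summing over \<open>v\<close> in \<open>w - v\<close>.\<close>

lemma circulant_eigenvalue: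
  assumes n: "n > 0" and c: "\<And>x. c (x mod int n) = c x"
    and f: "\<exists>v<n. f v \<noteq> 0" "\<And>v. v < n \<Longrightarrow> (\<Sum>w<n. c (int w - int v) * f w) = x * f v"
  shows "\<exists>m. x = fourier n c m"
proof -
  have "\<exists>m. fourier n (\<lambda>d. f (nat d)) m \<noteq> 0"
  proof (rule ccontr)
    assume "\<not> ?thesis"
    then have "of_nat n * f v = 0" if "v < n" for v
      using fourier_inversion[OF n that, of "\<lambda>d. f (nat d)"] by simp
    then show False using f(1) n by auto
  qed
  then obtain m where m: "(\<Sum>w<n. f w * unity n (int w * m)) \<noteq> 0"
    by (auto simp: fourier_def)
  have per: "c (y mod int n) * unity n (y mod int n * (- m)) = c y * unity n (y * (- m))" for y
    by (simp only: unity_mod_mult[OF n] c)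
  have "x * (\<Sum>v<n. f v * unity n (int v * m)) =
      (\<Sum>v<n. \<Sum>w<n. f w * unity n (int w * m) *
        (c (int w - int v) * unity n ((int w - int v) * (- m))))"
    unfolding sum_distrib_left
  proof (intro sum.cong refl)
    fix v assume "v \<in> {..<n}"
    then have "x * (f v * unity n (int v * m)) =
        (\<Sum>w<n. c (int w - int v) * f w) * unity n (int v * m)"
      using f(2) by simp
    also have "\<dots> = (\<Sum>w<n. f w * unity n (int w * m) *
        (c (int w - int v) * unity n ((int w - int v) * (- m))))"
      unfolding sum_distrib_right
    proof (intro sum.cong refl)
      fix w
      have "unity n (int v * m) = unity n (int w * m) * unity n ((int w - int v) * (- m))"
        by (simp flip: unity_add add: algebra_simps)
      then show "c (int w - int v) * f w * unity n (int v * m) = f w * unity n (int w * m) *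
        (c (int w - int v) * unity n ((int w - int v) * (- m)))" by simp
    qed
    finally show "x * (f v * unity n (int v * m)) = \<dots>" .
  qed
  also have "\<dots> = (\<Sum>w<n. f w * unity n (int w * m) *
      (\<Sum>v<n. c (int w - int v) * unity n ((int w - int v) * (- m))))"
    by (subst sum.swap) (simp only: sum_distrib_left)
  also have "\<dots> = fourier n c (- m) * (\<Sum>w<n. f w * unity n (int w * m))"
    unfolding sum_reflect_mod[OF n, of "\<lambda>d. c d * unity n (d * (- m))", OF per] fourier_def
    by (simp only: sum_distrib_right[symmetric] mult.commute)
  finally show ?thesis using m by auto
qed

section \<open>Congruences modulo a prime and invariance under multipliers\<close>

text \<open>The inner binomial coefficients are divisible by \<open>p\<close>. The ring is arbitrary
  because the application is to integer polynomials.\<close>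

lemma prime_dvd_binomial_power:
  fixes x y :: "'a :: comm_ring_1"
  assumes "prime p"
  shows "of_nat p dvd (x + y) ^ p - x ^ p - y ^ p"
proof -
  have p: "p > 0" using assms prime_gt_0_nat by blast
  have "{..p} = insert 0 (insert p {0<..<p})" by auto
  then have "(x + y) ^ p - x ^ p - y ^ p =
      (\<Sum>i\<in>{0<..<p}. of_nat (p choose i) * x ^ i * y ^ (p - i))"
    using p by (simp add: binomial_ring)
  also have "of_nat p dvd \<dots>"
  proof (intro dvd_sum dvd_mult2)
    fix i assume "i \<in> {0<..<p}"
    then have "p dvd p choose i" using assms by (intro dvd_choose_prime) auto
    then show "(of_nat p :: 'a) dvd of_nat (p choose i)" by (auto elim!: dvdE)
  qed
  finally show ?thesis .
qed

lemma prime_dvd_sum_power: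
  fixes x :: "'b \<Rightarrow> 'a :: comm_ring_1"
  assumes "prime p" "finite S"
  shows "of_nat p dvd (\<Sum>i\<in>S. x i) ^ p - (\<Sum>i\<in>S. x i ^ p)"
  using assms(2)
proof induction
  case empty
  then show ?case using assms(1) prime_gt_0_nat[of p] by (simp add: zero_power)
next
  case (insert i S)
  have "(x i + sum x S) ^ p - (x i ^ p + (\<Sum>i\<in>S. x i ^ p)) =
    ((x i + sum x S) ^ p - x i ^ p - sum x S ^ p) + (sum x S ^ p - (\<Sum>i\<in>S. x i ^ p))"
    by simp
  then show ?case
    using insert prime_dvd_binomial_power[OF assms(1), of "x i" "sum x S"]
    by (simp only: sum.insert dvd_add not_False_eq_True)
qed

lemma fermat_int:
  fixes a :: int
  assumes "prime p" "\<not> int p dvd a"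
  shows "[a ^ (p - 1) = 1] (mod int p)"
proof -
  define b where "b = nat (a mod int p)"
  have p: "p > 0" using assms prime_gt_0_nat by blast
  then have b: "int b = a mod int p" by (simp add: b_def)
  then have "\<not> p dvd b" using assms(2)
    by (metis dvd_mod_iff dvd_refl int_dvd_int_iff)
  then have "[b ^ (p - 1) = 1] (mod p)" using assms(1) by (rule fermat_theorem[rotated])
  then have "[int b ^ (p - 1) = 1] (mod int p)" by (metis cong_int_iff of_nat_1 of_nat_power)
  then show ?thesis unfolding b by (simp add: cong_def power_mod)
qed

lemma fermat_int_power:
  fixes a :: int
  assumes "prime p"
  shows "[a ^ p = a] (mod int p)"
proof (cases "int p dvd a")
  case True
  moreover have "p > 0" using assms prime_gt_0_nat by blast
  ultimately have "int p dvd a ^ p" using dvd_power[of p a] dvd_trans by blast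
  then show ?thesis using True by (simp add: cong_def)
next
  case False
  then have "[a * a ^ (p - 1) = a * 1] (mod int p)"
    by (intro cong_mult cong_refl fermat_int assms)
  moreover have "a * a ^ (p - 1) = a ^ p"
    using assms prime_gt_0_nat[of p] by (simp add: power_eq_if)
  ultimately show ?thesis by simp
qed

text \<open>Each power of X sums to 0 or \<open>n\<close> over the \<open>n\<close>-th roots of
  unity. This takes the place of the fact that traces of algebraic integers are integers.\<close>

lemma sum_poly_unity_in_Ints:
  fixes h :: "int poly"
  assumes "n > 0"
  shows "(\<Sum>j<n. poly (map_poly of_int h) (unity n (- int j))) \<in> \<int>"
proof -
  have "(\<Sum>j<n. poly (map_poly of_int h) (unity n (- int j))) =
      (\<Sum>j<n. \<Sum>i\<le>degree h. of_int (Polynomial.coeff h i) * unity n (int j * (- int i)))"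
    by (simp add: poly_altdef unity_power mult.commute)
  also have "\<dots> = (\<Sum>i\<le>degree h. of_int (Polynomial.coeff h i) * (\<Sum>j<n. unity n (int j * (- int i))))"
    by (subst sum.swap) (simp add: sum_distrib_left)
  also have "\<dots> \<in> \<int>"
  proof (rule Ints_sum)
    fix i
    have "(\<Sum>j<n. unity n (int j * (- int i))) \<in> \<int>" by (simp only: sum_unity[OF assms]) simp
    then show "of_int (Polynomial.coeff h i) * (\<Sum>j<n. unity n (int j * (- int i))) \<in> \<int>"
      by simp
  qed
  finally show ?thesis .
qed

text \<open>Frobenius gives \<open>f ^ p - f(X ^ p) = p * g\<close> for \<open>f = (\<Sum>m<n. a m * X ^ m)\<close>,
  whose values at the \<open>n\<close>-th roots of unity are the integers \<open>C j\<close>. The sum of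
  \<open>g ^ (p - 1)\<close> over all \<open>n\<close>-th roots of unity is an integer, so \<open>p\<close> divides the sum over \<open>j\<close>
  of \<open>(C j ^ p - C (p * j)) ^ (p - 1)\<close>, which by Fermat is congruent to the number of \<open>j < n\<close> with
  \<open>C j\<close> and \<open>C (p * j)\<close> incongruent; this number is smaller than \<open>p\<close>.\<close>

lemma fourier_values_cong_prime:
  fixes a :: "nat \<Rightarrow> int" and C :: "int \<Rightarrow> int"
  assumes n: "n > 0" and p: "prime p" "n < p"
    and C: "\<And>j. of_int (C j) = (\<Sum>m<n. of_int (a m) * unity n (- (int m * j)))"
    and j: "j < n"
  shows "[C (int j) = C (int p * int j)] (mod int p)"
proof -
  define f where "f = (\<Sum>m<n. Polynomial.monom (a m) m)"
  define f' where "f' = (\<Sum>m<n. Polynomial.monom (a m) (m * p))"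
  have p0: "p > 1" using p prime_gt_1_nat by blast
  have "of_nat p dvd f ^ p - (\<Sum>m<n. Polynomial.monom (a m) m ^ p)"
    unfolding f_def using p by (intro prime_dvd_sum_power) auto
  \<comment> \<open>Frobenius also raises the coefficients to the \<open>p\<close>-th power;
    Fermat's little theorem turns them back into \<open>a m\<close> modulo \<open>p\<close>.\<close>
  moreover have "of_nat p dvd (\<Sum>m<n. Polynomial.monom (a m) m ^ p) - f'"
    unfolding f'_def sum_subtractf[symmetric]
  proof (intro dvd_sum)
    fix m
    have "int p dvd a m ^ p - a m" using fermat_int_power[OF p(1)] by (simp add: cong_iff_dvd_diff)
    then obtain t where t: "a m ^ p - a m = int p * t" by blast
    have "Polynomial.monom (a m) m ^ p - Polynomial.monom (a m) (m * p) = Polynomial.monom (a m ^ p - a m) (m * p)"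
      by (simp add: monom_power mult.commute diff_monom)
    also have "\<dots> = of_nat p * Polynomial.monom t (m * p)"
      by (simp add: t of_nat_poly smult_monom)
    finally show "of_nat p dvd Polynomial.monom (a m) m ^ p - Polynomial.monom (a m) (m * p)" by simp
  qed
  ultimately have "of_nat p dvd (f ^ p - (\<Sum>m<n. Polynomial.monom (a m) m ^ p)) +
      ((\<Sum>m<n. Polynomial.monom (a m) m ^ p) - f')" by (rule dvd_add)
  then have "of_nat p dvd f ^ p - f'" by simp
  then obtain g where g: "f ^ p - f' = of_nat p * g" by blast
  define D where "D j = C j ^ p - C (int p * j)" for j
  let ?ev = "\<lambda>h j. poly (map_poly of_int h) (unity n (- int j))"
  have evf: "?ev f j = of_int (C (int j))" for j
    by (simp add: f_def C of_int_poly_hom.hom_sum poly_sum poly_monom unity_power)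
  have evf': "?ev f' j = of_int (C (int p * int j))" for j
    by (simp add: f'_def C of_int_poly_hom.hom_sum poly_sum poly_monom unity_power mult_ac)
  have D: "of_int (D (int j)) = of_nat p * ?ev g j" for j
  proof -
    have "?ev (f ^ p - f') j = of_int (D (int j))"
      by (simp add: of_int_poly_hom.hom_minus of_int_poly_hom.hom_power evf evf' D_def)
    then show ?thesis by (simp add: g of_nat_poly of_int_hom.map_poly_hom_smult)
  qed
  obtain s where s: "(\<Sum>j<n. ?ev (g ^ (p - 1)) j) = of_int s"
    using sum_poly_unity_in_Ints[OF n] by (auto elim: Ints_cases)
  have "of_int (\<Sum>j<n. D (int j) ^ (p - 1)) = (\<Sum>j<n. (of_nat p * ?ev g j) ^ (p - 1))"
    by (simp add: D)
  also have "\<dots> = of_nat p ^ (p - 1) * of_int s"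
    by (simp add: of_int_poly_hom.hom_power power_mult_distrib sum_distrib_left flip: s)
  also have "\<dots> = of_int (int p ^ (p - 1) * s)" by simp
  finally have "(\<Sum>j<n. D (int j) ^ (p - 1)) = int p ^ (p - 1) * s" by (simp only: of_int_eq_iff)
  then have *: "int p dvd (\<Sum>j<n. D (int j) ^ (p - 1))" using p0 by simp
  define J where "J = {j\<in>{..<n}. \<not> int p dvd D (int j)}"
  have "[(\<Sum>j<n. D (int j) ^ (p - 1)) = (\<Sum>j<n. if \<not> int p dvd D (int j) then 1 else 0)] (mod int p)"
  proof (intro cong_sum)
    fix j
    show "[D (int j) ^ (p - 1) = (if \<not> int p dvd D (int j) then 1 else 0)] (mod int p)"
      using fermat_int[OF p(1), of "D (int j)"] p0
      by (auto simp: cong_0_iff intro: dvd_trans[OF _ dvd_power])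
  qed
  also have "(\<Sum>j<n. if \<not> int p dvd D (int j) then 1 else 0) = int (card J)"
    by (simp add: J_def sum.If_cases Int_def)
  finally have "p dvd card J" using * by (metis cong_dvd_iff int_dvd_int_iff)
  moreover have "card J \<le> n" using card_mono[of "{..<n}" J] by (simp add: J_def subset_eq)
  ultimately have "card J = 0" using p(2) dvd_imp_le[of p "card J"] by linarith
  then have "J = {}" by (simp add: J_def)
  then have "int p dvd D (int j)" using j by (auto simp: J_def)
  \<comment> \<open>What is left of the Frobenius power is the exponent on \<open>C j\<close>, which
    Fermat's theorem removes.\<close>
  then have "[C (int j) ^ p = C (int p * int j)] (mod int p)"
    by (simp add: D_def cong_iff_dvd_diff)
  then show ?thesis
    by (rule cong_trans[OF cong_sym[OF fermat_int_power[OF p(1)]]])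
qed


lemma integral_circulant_invariant:
  fixes c :: "int \<Rightarrow> int"
  assumes n: "n > 0" and c: "\<And>x. c (x mod int n) = c x"
    and int: "\<And>m. fourier n (\<lambda>d. of_int (c d)) (int m) \<in> \<int>"
    and M: "coprime M n"
  shows "c (int M * j) = c j"
proof -
  have "\<forall>m. \<exists>a. fourier n (\<lambda>d. of_int (c d)) (int m) = of_int a"
    using int by (blast elim: Ints_cases)
  then obtain a where a: "\<And>m. fourier n (\<lambda>d. of_int (c d)) (int m) = of_int (a m)"
    by (auto dest: choice)
  \<comment> \<open>The factor \<open>n\<close> clears the denominator in Fourier inversion, so
    \<open>C\<close> is a combination of roots of unity with the integer coefficients
    \<open>a m\<close>.\<close>
  define C where "C j = int n * c j" for j
  have C: "of_int (C j) = (\<Sum>m<n. of_int (a m) * unity n (- (int m * j)))" for j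
  proof -
    have "unity n (- (int m * int (nat (j mod int n)))) = unity n (- (int m * j))" for m
      using unity_mod_mult[OF n, of j "- int m"] n by (simp add: mult.commute)
    then show ?thesis
      using fourier_inversion[OF n, of "nat (j mod int n)" "\<lambda>d. of_int (c d)"] n c
      by (simp add: C_def a nat_less_iff)
  qed
  define S where "S = (\<Sum>d<n. \<bar>c (int d)\<bar>)"
  have S: "\<bar>c x\<bar> \<le> S" for x
  proof -
    have "\<bar>c (int (nat (x mod int n)))\<bar> \<le> S"
      unfolding S_def using n by (intro member_le_sum) (auto simp: nat_less_iff)
    then show ?thesis using n c by simp
  qed
  \<comment> \<open>A prime above \<open>B\<close> exceeds \<open>n\<close>, as the congruence
    requires, and also \<open>2 * n * S\<close>, which bounds the difference of any two values of
    \<open>C\<close>. Congruent values are therefore equal.\<close>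
  define B where "B = n + nat (2 * int n * S)"
  have big_prime: "c (int p * j) = c j" if p: "prime p" "p > B" for p j
  proof -
    have *: "C (int j) = C (int p * int j)" if "j < n" for j
    proof -
      have "int p dvd C (int j) - C (int p * int j)"
        using fourier_values_cong_prime[OF n p(1) _ C that] p(2)
        by (simp add: B_def cong_iff_dvd_diff)
      moreover have "\<bar>C (int j) - C (int p * int j)\<bar> < int p"
      proof -
        have "\<bar>c (int j) - c (int p * int j)\<bar> \<le> 2 * S"
          using S[of "int j"] S[of "int p * int j"] by linarith
        then have "int n * \<bar>c (int j) - c (int p * int j)\<bar> \<le> int n * (2 * S)"
          by (rule mult_left_mono) simp
        then have "\<bar>C (int j) - C (int p * int j)\<bar> \<le> 2 * int n * S"
          by (simp add: C_def abs_mult flip: right_diff_distrib)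
        then show ?thesis using p(2) by (simp add: B_def)
      qed
      ultimately show ?thesis using dvd_imp_le_int[of "C (int j) - C (int p * int j)" "int p"]
        by fastforce
    qed
    have "c (int p * j) = c (int p * (j mod int n))"
      using c[of "int p * j"] c[of "int p * (j mod int n)"] by (simp add: mod_mult_right_eq)
    also have "\<dots> = c (j mod int n)"
      using *[of "nat (j mod int n)"] n by (simp add: C_def nat_less_iff)
    finally show ?thesis using c by simp
  qed
  have big: "c (int N * j) = c j" if "N > 0" "\<And>q. prime q \<Longrightarrow> q dvd N \<Longrightarrow> q > B" for N j
    using that
  proof (induction N arbitrary: j rule: less_induct)
    case (less N)
    show ?case
    proof (cases "N = 1")
      case False
      then obtain p where p: "prime p" "p dvd N" using prime_factor_nat by blast
      then obtain N' where N': "N = p * N'" by blast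
      have "p > 1" using p prime_gt_1_nat by blast
      then have "N' > 0" "N' < N" using less.prems(1) N' by auto
      then have "c (int N' * j) = c j" using less N' by auto
      then show ?thesis using big_prime[of p "int N' * j"] p less.prems(2) N' by (simp add: mult.assoc)
    qed simp
  qed
  \<comment> \<open>A prime \<open>q \<le> B\<close> divides exactly one of the summands of \<open>N\<close>.\<close>
  define Q where "Q = {q. prime q \<and> q \<le> B \<and> \<not> q dvd M}"
  have Q: "finite Q" by (rule finite_subset[of _ "{..B}"]) (auto simp: Q_def)
  define N where "N = M + n * \<Prod>Q"
  have Qpos: "\<Prod>Q > 0" using prime_gt_0_nat by (auto simp: Q_def intro!: prod_pos)
  have "q > B" if q: "prime q" "q dvd N" for q
  proof (rule ccontr)
    assume "\<not> q > B"
    show False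
    proof (cases "q dvd M")
      case True
      then have "q dvd n * \<Prod>Q" using q(2) by (simp add: N_def dvd_add_right_iff)
      moreover have "\<not> q dvd n" using True M q(1)
        by (metis coprime_common_divisor_nat not_prime_1)
      ultimately have "q dvd \<Prod>Q" using q(1) by (simp add: prime_dvd_mult_iff)
      then obtain r where "r \<in> Q" "q dvd r"
        using q(1) Q by (auto simp: prime_dvd_prod_iff)
      then show False using q(1) True primes_dvd_imp_eq by (auto simp: Q_def)
    next
      case False
      then have "q dvd \<Prod>Q" using q \<open>\<not> q > B\<close> Q by (intro dvd_prodI) (auto simp: Q_def)
      then show False using False q(2) by (simp add: N_def dvd_add_left_iff)
    qed
  qed
  moreover have "N > 0" using n Qpos by (simp add: N_def)
  ultimately have "c (int N * j) = c j" by (intro big)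
  moreover have "c (int N * j) = c (int M * j)"
    using c[of "int N * j"] c[of "int M * j"] by (simp add: N_def distrib_right mult.assoc)
  ultimately show ?thesis by simp
qed

section \<open>Edges and codegrees of the hypercycle\<close>

text \<open>For two vertices at cyclic distance \<open>d\<close>, \<open>x\<close> is the position
  of the first one inside an edge that contains both. At \<open>d = 0\<close> the value is not the
  zero diagonal entry of the adjacency matrix.\<close>

definition edge_overlap :: "nat \<Rightarrow> nat \<Rightarrow> int \<Rightarrow> nat" where
  "edge_overlap n k d = card {x. x < k \<and> (int x + d) mod int n < int k}"

lemma mem_hypercycle_edge_iff:
  assumes "k \<le> n" "v < n"
  shows "v \<in> hypercycle_edge n k j \<longleftrightarrow> (int v - int j) mod int n < int k"
proof
  assume "v \<in> hypercycle_edge n k j"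
  then obtain i where i: "i < k" "v = (j + i) mod n" by (auto simp: hypercycle_edge_def)
  have "(int v - int j) mod int n = int i mod int n"
    by (simp add: i zmod_int mod_diff_left_eq)
  then show "(int v - int j) mod int n < int k" using i assms by simp
next
  assume *: "(int v - int j) mod int n < int k"
  define i where "i = nat ((int v - int j) mod int n)"
  have i: "int i = (int v - int j) mod int n" using assms by (simp add: i_def)
  have "int ((j + i) mod n) = int v"
    using assms by (simp add: zmod_int i mod_add_right_eq)
  then have "v = (j + i) mod n" by linarith
  moreover have "i < k" using * i by linarith
  ultimately show "v \<in> hypercycle_edge n k j" by (auto simp: hypercycle_edge_def)
qed

text \<open>The edges form a set, so counting edges by their starting points requires these to be
  determined. The starting point of a proper arc is its only vertex whose predecessor lies outside
  the arc.\<close>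

lemma inj_on_hypercycle_edge:
  assumes "0 < k" "k < n"
  shows "inj_on (hypercycle_edge n k) {..<n}"
proof (rule inj_onI)
  fix i j assume ij: "i \<in> {..<n}" "j \<in> {..<n}" "hypercycle_edge n k i = hypercycle_edge n k j"
  have *: "(int v - int i) mod int n < int k \<longleftrightarrow> (int v - int j) mod int n < int k" if "v < n" for v
    using mem_hypercycle_edge_iff[of k n v i] mem_hypercycle_edge_iff[of k n v j] that assms ij(3)
    by simp
  \<comment> \<open>\<open>t\<close> is the position of \<open>i\<close> in the edge starting at
    \<open>j\<close>, and \<open>u\<close> is the predecessor of \<open>i\<close>. If
    \<open>t\<close> were nonzero, \<open>u\<close> would lie in that edge at position
    \<open>t - 1\<close>.\<close>
  define t where "t = (int i - int j) mod int n"
  define u where "u = nat ((int i - 1) mod int n)"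
  have u: "int u = (int i - 1) mod int n" "u < n" using assms by (auto simp: u_def nat_less_iff)
  have "t \<ge> 0" using assms by (simp add: t_def)
  have "t < int k" using *[of i] ij assms by (simp add: t_def)
  have "(int u - int i) mod int n = int n - 1"
    using assms by (simp add: u mod_diff_left_eq zmod_minus1)
  then have "\<not> (int u - int j) mod int n < int k" using *[of u] u assms by simp
  moreover have "(int u - int j) mod int n = (t - 1) mod int n"
    by (simp add: u t_def mod_diff_left_eq algebra_simps)
  moreover have "(t - 1) mod int n = t - 1" if "t \<noteq> 0"
    using that \<open>t \<ge> 0\<close> \<open>t < int k\<close> assms by (intro mod_pos_pos_trivial) linarith+
  ultimately have "t = 0" using \<open>t < int k\<close> by fastforce
  then have "int n dvd int i - int j" by (auto simp: t_def)
  then show "i = j" using ij by (auto simp: mod_eq_dvd_iff[symmetric])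
qed

lemma codegree_hypercycle:
  assumes "0 < k" "k < n" "v < n" "w < n"
  shows "codegree (hypercycle n k) v w = edge_overlap n k (int w - int v)"
proof -
  have "{e \<in> snd (hypercycle n k). v \<in> e \<and> w \<in> e} =
      hypercycle_edge n k ` {j. j < n \<and> v \<in> hypercycle_edge n k j \<and> w \<in> hypercycle_edge n k j}"
    by (auto simp: hypercycle_def)
  moreover have "inj_on (hypercycle_edge n k)
      {j. j < n \<and> v \<in> hypercycle_edge n k j \<and> w \<in> hypercycle_edge n k j}"
    by (rule inj_on_subset[OF inj_on_hypercycle_edge[OF assms(1,2)]]) auto
  ultimately have "codegree (hypercycle n k) v w =
      card {j. j < n \<and> v \<in> hypercycle_edge n k j \<and> w \<in> hypercycle_edge n k j}"
    by (simp add: codegree_def card_image)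
  also have "\<dots> = card {j \<in> {..<n}. (int v - int j) mod int n < int k \<and>
      (int w - int j) mod int n < int k}"
    using assms by (simp add: mem_hypercycle_edge_iff)
  also have "\<dots> = card {x. x < k \<and> (int x + (int w - int v)) mod int n < int k}"
  proof (rule bij_betw_same_card)
    have shift: "((int v - y) mod int n + (int w - int v)) mod int n = (int w - y) mod int n" for y
      unfolding mod_add_left_eq by (simp add: algebra_simps)
    have shift': "(int w - (int v - y)) mod int n = (y + (int w - int v)) mod int n" for y
      by (simp add: algebra_simps)
    \<comment> \<open>An edge is recorded by the position \<open>v - j\<close> of \<open>v\<close>
      in it; \<open>w\<close> then has position \<open>x + (w - v)\<close>. The reflection is its
      own inverse.\<close>
    show "bij_betw (\<lambda>j. nat ((int v - int j) mod int n))
        {j \<in> {..<n}. (int v - int j) mod int n < int k \<and> (int w - int j) mod int n < int k}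
        {x. x < k \<and> (int x + (int w - int v)) mod int n < int k}"
      by (rule bij_betw_byWitness[where f' = "\<lambda>x. nat ((int v - int x) mod int n)"])
        (use assms in \<open>auto simp: nat_less_iff mod_diff_right_eq shift shift'\<close>)
  qed
  finally show ?thesis by (simp add: edge_overlap_def)
qed

lemma edge_overlap_mod: "edge_overlap n k (d mod int n) = edge_overlap n k d"
  by (simp add: edge_overlap_def mod_add_right_eq)

lemma edge_overlap_1:
  assumes "0 < k" "k < n"
  shows "edge_overlap n k 1 = k - 1"
proof -
  have "{x. x < k \<and> (int x + 1) mod int n < int k} = {..<k - 1}"
    using assms by auto
  then show ?thesis by (simp add: edge_overlap_def)
qed

text \<open>A shift by 1 moves just one position out of the edge, whereas a shift by such a
  \<open>d\<close> moves out at least two.\<close>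

lemma edge_overlap_less:
  assumes "2 \<le> k" "k \<le> n - 2" "2 \<le> d" "d \<le> n - 2"
  shows "edge_overlap n k (int d) < k - 1"
proof -
  \<comment> \<open>This is the minimum of \<open>k - 1\<close> and \<open>n - 1 - d\<close>: the
    last position in the edge that the shift does not carry around the cycle. Both
    \<open>x - 1\<close> and \<open>x\<close> land between \<open>k\<close> and
    \<open>n - 1\<close>.\<close>
  define x where "x = (if d \<le> n - k then k - 1 else n - 1 - d)"
  have x: "0 < x" "x < k" "x + d < n" "k \<le> x - 1 + d" using assms by (auto simp: x_def)
  have "{y. y < k \<and> (int y + int d) mod int n < int k} \<subseteq> {..<k} - {x - 1, x}"
    using x by (auto simp flip: of_nat_add simp: zmod_int[symmetric])
  then have "edge_overlap n k (int d) \<le> card ({..<k} - {x - 1, x})"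
    unfolding edge_overlap_def by (intro card_mono) auto
  also have "\<dots> = k - 2" using x by (subst card_Diff_subset) (auto simp: card_insert_if)
  finally show ?thesis using assms by linarith
qed

text \<open>An edge now misses only position \<open>n - 1\<close>, so the single position lost is
  the one that the shift sends there. It is a position of the edge because \<open>d\<close> is not a
  multiple of \<open>n\<close>.\<close>

lemma edge_overlap_pred:
  assumes "n > 0" "\<not> int n dvd d"
  shows "edge_overlap n (n - 1) d = n - 2"
proof -
  define y where "y = nat ((- 1 - d) mod int n)"
  have y: "int y = (- 1 - d) mod int n" using assms by (simp add: y_def)
  have last: "(int x + d) mod int n < int (n - 1) \<longleftrightarrow> x \<noteq> y" if "x < n" for x
  proof -
    have "(int x + d) mod int n < int (n - 1) \<longleftrightarrow> (int x + d) mod int n \<noteq> int n - 1"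
    proof -
      define r where "r = (int x + d) mod int n"
      have "r < int n" using assms by (simp add: r_def)
      then show ?thesis using assms unfolding r_def[symmetric] by linarith
    qed
    also have "int n - 1 = (- 1) mod int n" using assms by (simp add: zmod_minus1)
    also have "(int x + d) mod int n = (- 1) mod int n \<longleftrightarrow> int n dvd int x + d + 1"
      by (simp add: mod_eq_dvd_iff)
    also have "\<dots> \<longleftrightarrow> int x mod int n = (- 1 - d) mod int n"
      by (simp add: mod_eq_dvd_iff algebra_simps)
    also have "\<dots> \<longleftrightarrow> x = y" using that y by auto
    finally show ?thesis .
  qed
  have "y \<noteq> n - 1"
  proof
    assume "y = n - 1"
    then have "(- 1 - d) mod int n = (- 1) mod int n"
      using y assms by (simp add: zmod_minus1 of_nat_diff)
    then show False using assms by (simp add: mod_eq_dvd_iff)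
  qed
  moreover have "int y < int n" using y assms by simp
  ultimately have "y < n - 1" by linarith
  have "{x. x < n - 1 \<and> (int x + d) mod int n < int (n - 1)} = {..<n - 1} - {y}"
    using last by auto
  then show ?thesis using \<open>y < n - 1\<close> by (simp add: edge_overlap_def)
qed

text \<open>A form that the simplifier can evaluate, for the sporadic cases with
  \<open>n = 4\<close> and \<open>n = 6\<close>.\<close>

lemma edge_overlap_code:
  "edge_overlap n k d = length (filter (\<lambda>x. (int x + d) mod int n < int k) [0..<k])"
proof -
  have "{x. x < k \<and> (int x + d) mod int n < int k} =
      set (filter (\<lambda>x. (int x + d) mod int n < int k) [0..<k])" by auto
  then show ?thesis unfolding edge_overlap_def by (simp only: distinct_card distinct_filter distinct_upt)
qed

section \<open>The spectrum of the hypercycle\<close>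

text \<open>The first row of the adjacency matrix as a periodic function; the case distinction
  restores the zero diagonal.\<close>

definition overlap_weight :: "nat \<Rightarrow> nat \<Rightarrow> int \<Rightarrow> int" where
  "overlap_weight n k d = (if int n dvd d then 0 else int (edge_overlap n k d))"

lemma overlap_weight_mod: "overlap_weight n k (d mod int n) = overlap_weight n k d"
  by (simp add: overlap_weight_def edge_overlap_mod dvd_mod_iff)

lemma eigenvalue_hypercycle_iff:
  assumes "0 < k" "k < n" "distinct vs" "set vs = {0..<n}"
  shows "eigenvalue (adjacency_matrix (hypercycle n k) vs) x \<longleftrightarrow>
    (\<exists>m. x = fourier n (\<lambda>d. of_int (overlap_weight n k d)) m)"
proof -
  let ?c = "\<lambda>d. complex_of_int (overlap_weight n k d)"
  have row: "(\<Sum>w \<in> {0..<n} - {v}. of_nat (codegree (hypercycle n k) v w) * f w) =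
      (\<Sum>w<n. ?c (int w - int v) * f w)" if "v < n" for f and v
  proof (rule sum.mono_neutral_cong_left)
    fix w assume "w \<in> {0..<n} - {v}"
    then have w: "w < n" "w \<noteq> v" by auto
    then have "\<not> int n dvd int w - int v"
      using that by (auto simp: mod_eq_dvd_iff[symmetric])
    then show "of_nat (codegree (hypercycle n k) v w) * f w = ?c (int w - int v) * f w"
      using codegree_hypercycle[OF assms(1,2) that w(1)] by (simp add: overlap_weight_def)
  qed (auto simp: overlap_weight_def)
  have n: "n > 0" using assms by simp
  show ?thesis
    unfolding eigenvalue_adjacency_matrix_iff[OF assms(3)] assms(4)
  proof
    assume "\<exists>f. (\<exists>v\<in>{0..<n}. f v \<noteq> 0) \<and> (\<forall>v\<in>{0..<n}.
      (\<Sum>w\<in>{0..<n} - {v}. of_nat (codegree (hypercycle n k) v w) * f w) = x * f v)"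
    then obtain f where f: "\<exists>v\<in>{0..<n}. f v \<noteq> 0" "\<forall>v\<in>{0..<n}.
      (\<Sum>w\<in>{0..<n} - {v}. of_nat (codegree (hypercycle n k) v w) * f w) = x * f v" by blast
    have "\<exists>v<n. f v \<noteq> 0" using f(1) by auto
    moreover have "(\<Sum>w<n. ?c (int w - int v) * f w) = x * f v" if "v < n" for v
      using f(2) row[OF that, of f] that by simp
    ultimately show "\<exists>m. x = fourier n ?c m"
      by (intro circulant_eigenvalue[OF n]) (simp_all add: overlap_weight_mod)
  next
    assume "\<exists>m. x = fourier n ?c m"
    then obtain m where m: "x = fourier n ?c m" by blast
    show "\<exists>f. (\<exists>v\<in>{0..<n}. f v \<noteq> 0) \<and> (\<forall>v\<in>{0..<n}.
      (\<Sum>w\<in>{0..<n} - {v}. of_nat (codegree (hypercycle n k) v w) * f w) = x * f v)"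
      using n fourier_eigenvector[OF n, of ?c _ m]
      by (intro exI[of _ "\<lambda>w. unity n (int w * m)"]) (auto simp: row overlap_weight_mod m)
  qed
qed

lemma integral_hypercycle_iff:
  assumes "0 < k" "k < n"
  shows "integral_hypergraph (hypercycle n k) \<longleftrightarrow>
    (\<forall>m. fourier n (\<lambda>d. of_int (overlap_weight n k d)) m \<in> \<int>)"
proof -
  have "fst (hypercycle n k) = {0..<n}" by (simp add: hypercycle_def)
  moreover have "distinct [0..<n]" "set [0..<n] = {0..<n}" by auto
  ultimately show ?thesis
    unfolding integral_hypergraph_def
    using eigenvalue_hypercycle_iff[OF assms] is_hypergraph_hypercycle by metis
qed

section \<open>Coprime residues, roots of unity of order 4 and 6, and the classification\<close>

text \<open>For odd \<open>n\<close> the number 2 works. For \<open>n = 2 * m\<close> it is the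
  largest odd number below \<open>m\<close> that has the form \<open>m - 1\<close> or
  \<open>m - 2\<close>: its gcd with \<open>m\<close> divides 1 or 2, and it is odd.\<close>

lemma exists_coprime_between:
  fixes n :: nat
  assumes "n \<ge> 3" "n \<notin> {3, 4, 6}"
  shows "\<exists>M. coprime M n \<and> 2 \<le> M \<and> M \<le> n - 2"
proof (cases "even n")
  case False
  then have "coprime 2 n" by simp
  moreover have "n \<ge> 5" using assms False by (cases "n = 4") auto
  ultimately show ?thesis by (intro exI[of _ 2]) auto
next
  case True
  then obtain m where m: "n = 2 * m" by blast
  then have "m \<ge> 4" using assms by auto
  define e where "e = (if even m then 1 else 2 :: nat)"
  have "odd (m - e)" using \<open>m \<ge> 4\<close> by (auto simp: e_def)
  have "gcd (m - (m - e)) (m - e) = gcd m (m - e)" by (rule gcd_diff1_nat) simp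
  moreover have "m - (m - e) = e" using \<open>m \<ge> 4\<close> by (simp add: e_def)
  moreover have "coprime e (m - e)" using \<open>odd (m - e)\<close> by (auto simp: e_def)
  ultimately have "coprime (m - e) m" by (metis coprime_iff_gcd_eq_1 gcd.commute)
  then have "coprime (m - e) n" using \<open>odd (m - e)\<close> by (simp add: m)
  moreover have "2 \<le> m - e" "m - e \<le> n - 2" using \<open>m \<ge> 4\<close> m by (auto simp: e_def)
  ultimately show ?thesis by blast
qed

lemma fourth_root_sum_in_Ints:
  fixes y :: complex
  assumes "y ^ 4 = 1"
  shows "y + y ^ 3 \<in> \<int>"
proof -
  have "(y ^ 2 - 1) * (y ^ 2 + 1) = y ^ 4 - 1" by (simp add: eval_nat_numeral algebra_simps)
  then have "(y ^ 2 - 1) * (y ^ 2 + 1) = 0" using assms by simp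
  then consider "y ^ 2 = 1" | "y ^ 2 + 1 = 0" by auto
  then show ?thesis
  proof cases
    case 1
    then have "y = 1 \<or> y = - 1" by (simp add: power2_eq_1_iff)
    then show ?thesis by auto
  next
    case 2
    moreover have "y + y ^ 3 = y * (y ^ 2 + 1)" by (simp add: eval_nat_numeral algebra_simps)
    ultimately show ?thesis by simp
  qed
qed

text \<open>The terms at \<open>d\<close> and \<open>6 - d\<close> are grouped. On each cyclotomic
  factor of \<open>y ^ 6 - 1\<close>, division with remainder leaves an integer constant for all
  three sums.\<close>

lemma sixth_root_sums_in_Ints:
  fixes y :: complex
  assumes "y ^ 6 = 1"
  shows "y + y ^ 5 \<in> \<int>" "y ^ 2 + y ^ 4 \<in> \<int>" "y ^ 3 \<in> \<int>"
proof -
  have "(y - 1) * (y + 1) * (y ^ 2 + y + 1) * (y ^ 2 - y + 1) = y ^ 6 - 1"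
    by (simp add: eval_nat_numeral algebra_simps)
  then have "(y - 1) * (y + 1) * (y ^ 2 + y + 1) * (y ^ 2 - y + 1) = 0" using assms by simp
  then consider "y = 1" | "y = - 1" | "y ^ 2 + y + 1 = 0" | "y ^ 2 - y + 1 = 0"
    by (auto simp: eq_neg_iff_add_eq_0)
  then have "y + y ^ 5 \<in> \<int> \<and> y ^ 2 + y ^ 4 \<in> \<int> \<and> y ^ 3 \<in> \<int>"
  proof cases
    case 3
    moreover have "y + y ^ 5 = (y ^ 2 + y + 1) * (y ^ 3 - y ^ 2 + 1) - 1"
      "y ^ 2 + y ^ 4 = (y ^ 2 + y + 1) * (y ^ 2 - y + 1) - 1"
      "y ^ 3 = (y ^ 2 + y + 1) * (y - 1) + 1"
      by (simp_all add: eval_nat_numeral algebra_simps)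
    ultimately show ?thesis by (simp only: mult_zero_left) simp
  next
    case 4
    moreover have "y + y ^ 5 = (y ^ 2 - y + 1) * (y ^ 3 + y ^ 2 - 1) + 1"
      "y ^ 2 + y ^ 4 = (y ^ 2 - y + 1) * (y ^ 2 + y + 1) - 1"
      "y ^ 3 = (y ^ 2 - y + 1) * (y + 1) - 1"
      by (simp_all add: eval_nat_numeral algebra_simps)
    ultimately show ?thesis by (simp only: mult_zero_left) simp
  qed auto
  then show "y + y ^ 5 \<in> \<int>" "y ^ 2 + y ^ 4 \<in> \<int>" "y ^ 3 \<in> \<int>" by auto
qed

lemma fourier_eq_sum_power: "fourier n c m = (\<Sum>d<n. c (int d) * unity n m ^ d)"
  by (simp add: fourier_def unity_power)

theorem theorem2:
  fixes n k :: nat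
  assumes "n \<ge> 3" and "2 \<le> k" and "k \<le> n - 1"
  shows "integral_hypergraph (hypercycle n k) \<longleftrightarrow>
    k = n - 1 \<or> (n, k) \<in> {(4, 2), (6, 2), (6, 3), (6, 4)}"
proof
  let ?c = "\<lambda>d. complex_of_int (overlap_weight n k d)"
  have kn: "0 < k" "k < n" and n: "n > 0" using assms by linarith+
  {
    assume "integral_hypergraph (hypercycle n k)"
    then have int: "fourier n ?c m \<in> \<int>" for m using integral_hypercycle_iff[OF kn] by simp
    have "k = n - 1 \<or> n \<in> {3, 4, 6}"
    proof (rule ccontr)
      assume *: "\<not> ?thesis"
      then obtain M where M: "coprime M n" "2 \<le> M" "M \<le> n - 2"
        using exists_coprime_between assms by blast
      have "overlap_weight n k (int M * 1) = overlap_weight n k 1"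
        by (rule integral_circulant_invariant[OF n overlap_weight_mod int M(1)])
      moreover have "\<not> int n dvd int M" "\<not> int n dvd 1"
        using M assms by (auto dest: dvd_imp_le)
      ultimately have "edge_overlap n k (int M) = edge_overlap n k 1"
        by (simp add: overlap_weight_def)
      moreover have "k \<noteq> n - 1" using * by simp
      then have "k \<le> n - 2" using assms by linarith
      ultimately show False using edge_overlap_1[OF kn] edge_overlap_less[of k n M] M assms by simp
    qed
    \<comment> \<open>For \<open>n = 3\<close> the bounds force \<open>k = 2\<close>, which is
      \<open>n - 1\<close>; for 4 and 6 they leave exactly the listed pairs.\<close>
    then show "k = n - 1 \<or> (n, k) \<in> {(4, 2), (6, 2), (6, 3), (6, 4)}" using assms by auto
  next
    assume "k = n - 1 \<or> (n, k) \<in> {(4, 2), (6, 2), (6, 3), (6, 4)}"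
    then consider "k = n - 1" | "n = 4" "k = 2" | "n = 6" "k \<in> {2, 3, 4}" by auto
    then have "fourier n ?c m \<in> \<int>" for m
    proof cases
      case 1
      \<comment> \<open>All off-diagonal entries equal \<open>n - 2\<close>, so the matrix is a
        multiple of that of the complete graph.\<close>
      have "fourier n ?c m = of_int (int n - 2) * (\<Sum>d\<in>{..<n} - {0}. unity n (int d * m))"
        unfolding fourier_def sum_distrib_left
      proof (rule sum.mono_neutral_cong_right)
        fix d assume "d \<in> {..<n} - {0}"
        then have "\<not> int n dvd int d" by (auto dest: dvd_imp_le)
        then show "?c (int d) * unity n (int d * m) = of_int (int n - 2) * unity n (int d * m)"
          using edge_overlap_pred[OF n] assms by (simp add: overlap_weight_def 1 of_nat_diff)
      qed (auto simp: overlap_weight_def)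
      also have "(\<Sum>d\<in>{..<n} - {0}. unity n (int d * m)) = (\<Sum>d<n. unity n (int d * m)) - 1"
        using n by (subst sum_diff1) auto
      also have "of_int (int n - 2) * ((\<Sum>d<n. unity n (int d * m)) - 1) \<in> \<int>"
        by (simp add: sum_unity[OF n])
      finally show ?thesis .
    next
      case 2
      have "unity 4 m ^ 4 = 1" by (simp add: unity_power unity_eq_1_iff)
      then show ?thesis using fourth_root_sum_in_Ints[of "unity 4 m"]
        by (simp add: 2 fourier_eq_sum_power overlap_weight_def edge_overlap_code
            lessThan_nat_numeral numeral_eq_Suc)
    next
      case 3
      let ?y = "unity 6 m"
      have "?y ^ 6 = 1" by (simp add: unity_power unity_eq_1_iff)
      note y = sixth_root_sums_in_Ints[OF this]
      \<comment> \<open>The weights at \<open>d\<close> and \<open>6 - d\<close> agree, which pairs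
        conjugate powers.\<close>
      have "fourier n ?c m = of_int (overlap_weight n k 1) * (?y + ?y ^ 5) +
          of_int (overlap_weight n k 2) * (?y ^ 2 + ?y ^ 4) + of_int (overlap_weight n k 3) * ?y ^ 3"
        using 3 by (auto simp: fourier_eq_sum_power overlap_weight_def edge_overlap_code
            numeral_eq_Suc)
      also have "\<dots> \<in> \<int>" using y by simp
      finally show ?thesis .
    qed
    then show "integral_hypergraph (hypercycle n k)" using integral_hypercycle_iff[OF kn] by simp
  }
qed

end
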